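(* Let $\alpha\in\mathbb{R}$ and $\lambda\ge 0$. Let $n\ge 2$ and $m>n$ be integers, let data points $(x_i,y_i)\in\mathbb{R}^2$, $i=1,\ldots,m$, be given with $x_1<\cdots<x_m$, put $a=x_1$, $b=x_m$, $h=(b-a)/(n-1)$, and let $\xi_\ell=a+(\ell-1)h$ for $\ell=-2,-1,\ldots,n+3$ be the extended uniform knots, so that $\xi_1=a$ and $\xi_n=b$. Let $B^\alpha_0,\ldots,B^\alpha_{n+1}$ be the uniform hyperbolic-polynomial B-splines $B^\alpha_0=B^h_{\boldsymbol{\alpha}h}(\cdot-\xi_{-2})$ and $B^\alpha_j=B^\alpha_0(\cdot-jh)$, $j=1,\ldots,n+1$. Let $s_{hp}=\sum_{j=0}^{n+1}\hat a_jB^\alpha_j$ be the HP-spline with smoothing parameter $\lambda$ approximating the data $(x_i,y_i)$. If there is a function $f\in\mathbb{E}_{2,-\alpha}$ such that $y_i=f(x_i)$ for all $i=1,\ldots,m$, then $$s_{hp}(x_i)=y_i,\qquad i=1,\ldots,m.$$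
   Context: Function space: $\mathbb{E}_{2,-\alpha}=\operatorname{span}\{e^{-\alpha x},\,x\,e^{-\alpha x}\}$ (real-valued functions of $x\in\mathbb{R}$). Hyperbolic-polynomial B-splines (HB-splines): for $\beta\in\mathbb{R}$ let $B^1_\beta(x)=e^{\beta x}\chi_{[0,1]}(x)$. For $\boldsymbol{\beta}=(\beta,\beta,-\beta,-\beta)$ let $B^1_{\boldsymbol{\beta}}=B^1_\beta\ast B^1_\beta\ast B^1_{-\beta}\ast B^1_{-\beta}$ (convolution on $\mathbb{R}$), and for $h>0$ let $B^h_{\boldsymbol{\beta}}(x)=B^1_{\boldsymbol{\beta}}(x/h)$. With $\boldsymbol{\alpha}=(\alpha,\alpha,-\alpha,-\alpha)$, $\boldsymbol{\alpha}h=(\alpha h,\alpha h,-\alpha h,-\alpha h)$, so $$B^h_{\boldsymbol{\alpha}h}(x)=\left(B^1_{\alpha h}\ast B^1_{\alpha h}\ast B^1_{-\alpha h}\ast B^1_{-\alpha h}\right)(x/h),$$ which is supported on $[0,4h]$. Difference operator on sequences: $(\Delta^{h,\alpha}_2\mathbf{a})_j=a_j-2e^{-\alpha h}a_{j-1}+e^{-2\alpha h}a_{j-2}$. HP-spline: the HP-spline approximating the data $(x_i,y_i)$ is $s_{hp}(x)=\sum_{j=0}^{n+1}\hat a_jB^\alpha_j(x)$, where $\hat{\mathbf{a}}=(\hat a_0,\ldots,\hat a_{n+1})^T\in\mathbb{R}^{n+2}$ is a minimizer of $$\sum_{i=1}^m\Big(y_i-\sum_{j=0}^{n+1}a_jB^\alpha_j(x_i)\Big)^2+\lambda\sum_{j=2}^{n+1}\big((\Delta^{h,\alpha}_2\mathbf{a})_j\big)^2$$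 over $\mathbf{a}=(a_0,\ldots,a_{n+1})^T\in\mathbb{R}^{n+2}$. Equivalently, $\hat{\mathbf{a}}$ solves the linear system $$\left((\mathbf{B}^\alpha)^T\mathbf{B}^\alpha+\lambda(\mathbf{D}^{h,\alpha}_2)^T\mathbf{D}^{h,\alpha}_2\right)\mathbf{a}=(\mathbf{B}^\alpha)^T\mathbf{y},$$ where $\mathbf{y}=(y_1,\ldots,y_m)^T$, $\mathbf{B}^\alpha=(B^\alpha_j(x_i))_{i=1,\ldots,m}^{j=0,\ldots,n+1}\in\mathbb{R}^{m\times(n+2)}$ and $\mathbf{D}^{h,\alpha}_2\in\mathbb{R}^{n\times(n+2)}$ is the matrix with $\mathbf{D}^{h,\alpha}_2\mathbf{a}=((\Delta^{h,\alpha}_2\mathbf{a})_j)_{j=2}^{n+1}$. *)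

theory Defs
  imports "HOL-Analysis.Analysis"
begin

definition convolution :: "(real \<Rightarrow> real) \<Rightarrow> (real \<Rightarrow> real) \<Rightarrow> real \<Rightarrow> real"
  where "convolution f g = (\<lambda>x. LINT t|lborel. f t * g (x - t))"

definition hb1 :: "real \<Rightarrow> real \<Rightarrow> real"
  where "hb1 \<beta> = (\<lambda>x. exp (\<beta> * x) * indicat_real {0..1} x)"

(* The scalar \<beta> stands for the exponent vector (\<beta>, \<beta>, -\<beta>, -\<beta>). *)
definition hb_unit_spline :: "real \<Rightarrow> real \<Rightarrow> real"
  where "hb_unit_spline \<beta> =
    convolution (convolution (convolution (hb1 \<beta>) (hb1 \<beta>)) (hb1 (- \<beta>))) (hb1 (- \<beta>))"

(* Only the argument is scaled by h; the exponents are not, so the spline for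
   (\<alpha>, \<alpha>, -\<alpha>, -\<alpha>) with knot spacing h is hb_spline h (\<alpha> * h). *)
definition hb_spline :: "real \<Rightarrow> real \<Rightarrow> real \<Rightarrow> real"
  where "hb_spline h \<beta> = (\<lambda>x. hb_unit_spline \<beta> (x / h))"

definition exp_poly_space :: "real \<Rightarrow> (real \<Rightarrow> real) set"
  where "exp_poly_space \<beta> =
    {f. \<exists>c d. f = (\<lambda>x. c * exp (\<beta> * x) + d * (x * exp (\<beta> * x)))}"

(* Only used for j \<ge> 2, where the subtractions on nat do not truncate. *)
definition hp_diff :: "real \<Rightarrow> real \<Rightarrow> (nat \<Rightarrow> real) \<Rightarrow> nat \<Rightarrow> real"
  where "hp_diff h \<alpha> a j =
    a j - 2 * exp (- \<alpha> * h) * a (j - 1) + exp (- 2 * \<alpha> * h) * a (j - 2)"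

definition hp_objective ::
  "real \<Rightarrow> real \<Rightarrow> real \<Rightarrow> nat \<Rightarrow> nat \<Rightarrow> (nat \<Rightarrow> real \<Rightarrow> real) \<Rightarrow>
    (nat \<Rightarrow> real) \<Rightarrow> (nat \<Rightarrow> real) \<Rightarrow> (nat \<Rightarrow> real) \<Rightarrow> real"
  where "hp_objective \<alpha> h \<mu> n m B x y a =
    (\<Sum>i=1..m. (y i - (\<Sum>j=0..n+1. a j * B j (x i)))\<^sup>2)
      + \<mu> * (\<Sum>j=2..n+1. (hp_diff h \<alpha> a j)\<^sup>2)"

(* Vectors (a_0, ..., a_{n+1}) are represented by functions on nat; the objective and
   the spline depend only on the entries with index at most n + 1. *)
definition is_hp_spline ::
  "real \<Rightarrow> real \<Rightarrow> real \<Rightarrow> nat \<Rightarrow> nat \<Rightarrow> (nat \<Rightarrow> real \<Rightarrow> real) \<Rightarrow>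
    (nat \<Rightarrow> real) \<Rightarrow> (nat \<Rightarrow> real) \<Rightarrow> (real \<Rightarrow> real) \<Rightarrow> bool"
  where "is_hp_spline \<alpha> h \<mu> n m B x y s \<longleftrightarrow>
    (\<exists>a. is_arg_min (hp_objective \<alpha> h \<mu> n m B x y) (\<lambda>_. True) a \<and>
         s = (\<lambda>t. \<Sum>j=0..n+1. a j * B j t))"

end

theory Submission
  imports Defs
begin

text \<open>
  Multiplying by \<open>exp (\<beta> * v)\<close> turns convolution with the B-spline of exponent \<open>- \<beta>\<close> into a
  moving integral over a window of length 1. Integer shifts of such windows tile the line, so
  the weighted unit spline reproduces constants (one moving integral) and, by a second moving
  integral and a summation by parts, linear functions. Hence every \<open>f\<close> in the exponential
  polynomial space is, on the data interval, a spline whose coefficients have the form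
  \<open>exp (- \<alpha> * h * j) * (p + q * j)\<close>. These are annihilated by the difference operator, so the
  objective has minimum 0 and every minimizer interpolates the data.
\<close>

section \<open>Moving integrals of continuous functions\<close>

text \<open>This is convolution with the indicator of \<open>{0..1}\<close>, written as an integral
  with variable endpoints so that the fundamental theorem of calculus applies.\<close>

definition moving_integral :: "(real \<Rightarrow> real) \<Rightarrow> real \<Rightarrow> real"
  where "moving_integral g v = integral {v - 1..v} g"

lemma moving_integral_has_real_derivative:
  assumes "continuous_on UNIV g"
  shows "(moving_integral g has_real_derivative g v - g (v - 1)) (at v)"
proof -
  \<comment> \<open>The base point lies below \<open>u - 1\<close> for every
    \<open>u > v - 1\<close>, so one antiderivative \<open>F\<close> serves both ends of the
    window.\<close>
  define c where "c = v - 2"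
  define F where "F u = integral {c..u} g" for u
  have cont: "continuous_on S g" for S
    using assms continuous_on_subset by blast
  have F: "(F has_real_derivative g u) (at u)" if "u \<in> {c<..<v + 1}" for u
  proof -
    have "(F has_real_derivative g u) (at u within {c..v + 1})"
      unfolding F_def using that by (intro integral_has_real_derivative cont) auto
    then show ?thesis
      using that at_within_interior[of u "{c..v + 1}"] by simp
  qed
  have "((\<lambda>u. F u - F (u - 1)) has_real_derivative g v - g (v - 1)) (at v)"
    by (rule derivative_eq_intros F DERIV_chain2[where f = F] refl | simp add: c_def)+
  moreover have "F u - F (u - 1) = moving_integral g u" if "u \<in> {v - 1<..<v + 1}" for u
  proof -
    have "integral {c..u - 1} g + integral {u - 1..u} g = integral {c..u} g"
      using that by (intro Henstock_Kurzweil_Integration.integral_combine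
          integrable_continuous_real cont) (auto simp: c_def)
    then show ?thesis by (simp add: F_def moving_integral_def)
  qed
  ultimately show ?thesis
    using has_field_derivative_transform_within_open[where S = "{v - 1<..<v + 1}"] by auto
qed

lemma continuous_on_moving_integral:
  assumes "continuous_on UNIV g"
  shows "continuous_on S (moving_integral g)"
  using moving_integral_has_real_derivative[OF assms]
  by (intro DERIV_continuous_on) (blast intro: has_field_derivative_at_within)

lemma sum_moving_integral_shifts:
  assumes "continuous_on UNIV g"
  shows "(\<Sum>j=0..N. moving_integral g (v - real j)) = integral {v - real N - 1..v} g"
proof (induction N)
  case 0
  then show ?case by (simp add: moving_integral_def)
next
  case (Suc N)
  have "integral {v - real N - 2..v - real N - 1} g + integral {v - real N - 1..v} g
      = integral {v - real N - 2..v} g"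
    by (intro Henstock_Kurzweil_Integration.integral_combine integrable_continuous_real
        continuous_on_subset[OF assms]) auto
  then show ?case
    using Suc by (simp add: moving_integral_def algebra_simps)
qed

lemma integral_eq_on_support:
  fixes g :: "real \<Rightarrow> real"
  assumes "\<And>x. x \<notin> {0..r} \<Longrightarrow> g x = 0" "c \<le> 0" "r \<le> d"
  shows "integral {c..d} g = integral {0..r} g"
proof (rule integral_spike_set)
  have "{x \<in> {c..d} - {0..r}. g x \<noteq> 0} = {}" "{x \<in> {0..r} - {c..d}. g x \<noteq> 0} = {}"
    using assms by auto
  then show "negligible {x \<in> {c..d} - {0..r}. g x \<noteq> 0}"
    "negligible {x \<in> {0..r} - {c..d}. g x \<noteq> 0}"
    by (simp_all only: negligible_empty)
qed

text \<open>With an open support interval, a window that only touches its boundary already sees the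
  zero function; this covers \<open>v = 0\<close> and \<open>v = r + 1\<close>.\<close>

lemma moving_integral_support:
  assumes "\<And>x. x \<notin> {0<..<r} \<Longrightarrow> g x = 0" "v \<notin> {0<..<r + 1}"
  shows "moving_integral g v = 0"
  using assms unfolding moving_integral_def
  by (intro integral_unique has_integral_is_0) auto

text \<open>The derivative of the weighted sum is constant on the given range: summation by parts
  turns it into a plain sum of shifted moving integrals, which tile the support of \<open>p\<close>.
  The value of \<open>C\<close> is left open because a later choice of coefficients absorbs
  it.\<close>

lemma sum_weighted_moving_integral_shifts:
  fixes p :: "real \<Rightarrow> real"
  assumes cont: "continuous_on UNIV p"
    and supp: "\<And>x. x \<notin> {0<..<r} \<Longrightarrow> p x = 0"
  obtains C where "\<And>v. v \<in> {r + 1..real N + 1} \<Longrightarrow>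
    (\<Sum>j=0..N. real j * moving_integral (moving_integral p) (v - real j))
      = integral {0..r} p * v + C"
proof -
  define L where "L = moving_integral p"
  define S where "S v = (\<Sum>j=0..N. real j * moving_integral L (v - real j))" for v
  have contL: "continuous_on UNIV L"
    unfolding L_def by (rule continuous_on_moving_integral[OF cont])
  have abel: "(\<Sum>j=0..k. real j * (L (v - real j) - L (v - real j - 1)))
      = (\<Sum>j=0..k. L (v - real j)) - L v - real k * L (v - real k - 1)" for v k
    by (induction k) (auto simp: algebra_simps)
  have sumL: "(\<Sum>j=0..N. L (v - real j)) - L v = integral {0..r} p"
    \<comment> \<open>Removing \<open>L v\<close> cuts off the topmost window. The rest,
      \<open>{v - real N - 1..v - 1}\<close>, contains \<open>{0..r}\<close> exactly for
      \<open>v\<close> in this range.\<close>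
    if "v \<in> {r + 1..real N + 1}" for v
  proof -
    have comb: "integral {v - real N - 1..v - 1} p + integral {v - 1..v} p
        = integral {v - real N - 1..v} p"
      by (intro Henstock_Kurzweil_Integration.integral_combine integrable_continuous_real
        continuous_on_subset[OF cont]) auto
    have "integral {v - real N - 1..v - 1} p = integral {0..r} p"
      using that supp by (intro integral_eq_on_support) auto
    then show ?thesis
      using comb unfolding L_def sum_moving_integral_shifts[OF cont]
      by (simp add: moving_integral_def)
  qed
  have "\<exists>C. \<forall>v\<in>{r + 1..real N + 1}. S v - integral {0..r} p * v = C"
  proof (rule has_field_derivative_zero_constant)
    fix v assume v: "v \<in> {r + 1..real N + 1}"
    have "(S has_real_derivative
        (\<Sum>j=0..N. real j * (L (v - real j) - L (v - real j - 1)))) (at v)"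
      unfolding S_def
      by (rule derivative_eq_intros refl
          DERIV_chain2[OF moving_integral_has_real_derivative[OF contL]]
          | simp add: mult.commute)+
    \<comment> \<open>This is the boundary term of the summation by parts.\<close>
    moreover have "L (v - real N - 1) = 0"
      unfolding L_def using v by (intro moving_integral_support supp) auto
    ultimately have "(S has_real_derivative integral {0..r} p) (at v)"
      using sumL[OF v] by (simp add: abel)
    then have "((\<lambda>v. S v - integral {0..r} p * v) has_real_derivative 0) (at v)"
      by (auto intro!: derivative_eq_intros)
    then show "((\<lambda>v. S v - integral {0..r} p * v) has_real_derivative 0)
        (at v within {r + 1..real N + 1})"
      by (rule has_field_derivative_at_within)
  qed auto
  then obtain C where "\<And>v. v \<in> {r + 1..real N + 1} \<Longrightarrow> S v - integral {0..r} p * v = C"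
    by blast
  then show ?thesis
    by (intro that[of C]) (auto simp: S_def L_def algebra_simps)
qed

lemma integral_pos_of_continuous:
  fixes g :: "real \<Rightarrow> real"
  assumes "continuous_on {a..b} g" "\<And>x. x \<in> {a..b} \<Longrightarrow> 0 \<le> g x"
    and "a < b" "c \<in> {a..b}" "0 < g c"
  shows "0 < integral {a..b} g"
proof -
  have "integral {a..b} g \<noteq> 0"
    using integral_eq_0_iff[of a b g] assms by force
  moreover have "0 \<le> integral {a..b} g"
    using assms by (intro Henstock_Kurzweil_Integration.integral_nonneg
        integrable_continuous_real) auto
  ultimately show ?thesis by simp
qed

section \<open>The unit spline as an iterated moving integral\<close>

text \<open>For equal exponents the exponential part of the integrand does not depend on
  \<open>t\<close>, so what remains is the length of the overlap of \<open>{0..1}\<close> and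
  \<open>{x - 1..x}\<close>: the hat function.\<close>

lemma convolution_hb1_self:
  "convolution (hb1 \<beta>) (hb1 \<beta>) x = exp (\<beta> * x) * max 0 (1 - \<bar>x - 1\<bar>)"
proof -
  have "hb1 \<beta> t * hb1 \<beta> (x - t)
      = exp (\<beta> * x) * indicat_real {max 0 (x - 1)..min 1 x} t" for t
    by (auto simp: hb1_def indicator_def algebra_simps simp flip: exp_add)
  then have "convolution (hb1 \<beta>) (hb1 \<beta>) x
      = exp (\<beta> * x) * measure lborel {max 0 (x - 1)..min 1 x}"
    by (simp add: convolution_def)
  also have "measure lborel {max 0 (x - 1)..min 1 x} = max 0 (1 - \<bar>x - 1\<bar>)"
    by (cases "max 0 (x - 1) \<le> min 1 x") (auto simp: max_def min_def abs_if)
  finally show ?thesis .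
qed

lemma convolution_hb1:
  assumes "continuous_on UNIV f"
  shows "convolution f (hb1 (- \<beta>)) v
    = exp (- \<beta> * v) * moving_integral (\<lambda>t. exp (\<beta> * t) * f t) v"
proof -
  let ?g = "\<lambda>t. exp (\<beta> * t) * f t"
  have "f t * hb1 (- \<beta>) (v - t)
      = exp (- \<beta> * v) * (indicat_real {v - 1..v} t *\<^sub>R ?g t)" for t
    by (auto simp: hb1_def indicator_def algebra_simps simp flip: exp_add)
  then have "convolution f (hb1 (- \<beta>)) v
      = exp (- \<beta> * v) * (LINT t:{v - 1..v}|lborel. ?g t)"
    unfolding convolution_def set_lebesgue_integral_def by (simp only: integral_mult_right_zero)
  also have "(LINT t:{v - 1..v}|lborel. ?g t) = moving_integral ?g v"
    unfolding moving_integral_def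
    by (intro set_borel_integral_eq_integral(2) borel_integrable_atLeastAtMost'
        continuous_intros continuous_on_subset[OF assms]) auto
  finally show ?thesis .
qed

text \<open>The factor \<open>exp (- \<beta> * v)\<close> left by one convolution cancels the weight
  of the next, so the moving integrals compose directly. The exponent \<open>2 * \<beta>\<close>
  combines the factor of the hat function with the first weight.\<close>

lemma hb_unit_spline_eq_moving_integral:
  "hb_unit_spline \<beta> v = exp (- \<beta> * v) * moving_integral
    (moving_integral (\<lambda>x. exp (2 * \<beta> * x) * max 0 (1 - \<bar>x - 1\<bar>))) v"
proof -
  let ?p = "\<lambda>x. exp (2 * \<beta> * x) * max 0 (1 - \<bar>x - 1\<bar>)"
  have cont: "continuous_on UNIV ?p"
    by (intro continuous_intros)
  have "convolution (hb1 \<beta>) (hb1 \<beta>) = (\<lambda>x. exp (\<beta> * x) * max 0 (1 - \<bar>x - 1\<bar>))"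
    by (rule ext) (rule convolution_hb1_self)
  moreover have "continuous_on UNIV (\<lambda>x. exp (\<beta> * x) * max 0 (1 - \<bar>x - 1\<bar>))"
    by (intro continuous_intros)
  moreover have "(\<lambda>t. exp (\<beta> * t) * (exp (\<beta> * t) * max 0 (1 - \<bar>t - 1\<bar>))) = ?p"
    by (simp add: algebra_simps flip: exp_add mult.assoc)
  ultimately have "convolution (convolution (hb1 \<beta>) (hb1 \<beta>)) (hb1 (- \<beta>))
      = (\<lambda>v. exp (- \<beta> * v) * moving_integral ?p v)"
    by (intro ext) (simp only: convolution_hb1)
  moreover have "continuous_on UNIV (\<lambda>v. exp (- \<beta> * v) * moving_integral ?p v)"
    by (intro continuous_intros continuous_on_moving_integral[OF cont])
  moreover have "(\<lambda>t. exp (\<beta> * t) * (exp (- \<beta> * t) * moving_integral ?p t))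
      = moving_integral ?p"
    by (intro ext) (simp flip: exp_add mult.assoc)
  ultimately show ?thesis
    by (simp only: hb_unit_spline_def convolution_hb1)
qed

section \<open>Reproduction of exponential polynomials\<close>

lemma hb_unit_spline_reproduction:
  fixes \<beta> c d :: real
  obtains p q where "\<And>v. v \<in> {3..real N + 1} \<Longrightarrow>
    (\<Sum>j=0..N. exp (- \<beta> * real j) * (p + q * real j) * hb_unit_spline \<beta> (v - real j))
      = exp (- \<beta> * v) * (c + d * v)"
proof -
  define k where "k x = exp (2 * \<beta> * x) * max 0 (1 - \<bar>x - 1\<bar>)" for x
  define L where "L = moving_integral k"
  define G where "G = moving_integral L"
  define I where "I = integral {0..2} k"
  define J where "J = integral {0..3} L"
  have contk: "continuous_on S k" for S
    unfolding k_def by (intro continuous_intros)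
  have contL: "continuous_on S L" for S
    unfolding L_def by (rule continuous_on_moving_integral[OF contk])
  have k_nonneg: "0 \<le> k x" for x
    by (simp add: k_def)
  have k_supp: "k x = 0" if "x \<notin> {0<..<2}" for x
    using that by (auto simp: k_def max_def abs_if)
  \<comment> \<open>\<open>I\<close> and \<open>J\<close> become divisors below. The point 1 is the
    peak of the hat and lies both in \<open>{0..2}\<close> and in the window \<open>{1..2}\<close>
    of \<open>L 2\<close>.\<close>
  have "0 < I"
    unfolding I_def
    by (rule integral_pos_of_continuous[where c = 1]) (auto simp: contk k_nonneg, simp add: k_def)
  have "0 < L 2"
    unfolding L_def moving_integral_def
    by (rule integral_pos_of_continuous[where c = 1]) (auto simp: contk k_nonneg, simp add: k_def)
  moreover have "0 \<le> L v" for v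
    unfolding L_def moving_integral_def
    by (intro Henstock_Kurzweil_Integration.integral_nonneg integrable_continuous_real contk k_nonneg)
  ultimately have "0 < J"
    unfolding J_def by (intro integral_pos_of_continuous[where c = 2] contL) auto
  have L_supp: "L v = 0" if "v \<notin> {0..3}" for v
    unfolding L_def using that by (intro moving_integral_support[where r = 2] k_supp) auto
  obtain C where C: "\<And>v. v \<in> {3..real N + 1} \<Longrightarrow>
      (\<Sum>j=0..N. real j * G (v - real j)) = I * v + C"
    unfolding G_def L_def I_def
    by (rule sum_weighted_moving_integral_shifts[OF contk, where r = 2 and N = N])
      (auto simp: k_supp)
  have sumG: "(\<Sum>j=0..N. G (v - real j)) = J" if "v \<in> {3..real N + 1}" for v
    unfolding G_def J_def sum_moving_integral_shifts[OF contL]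
    using that by (intro integral_eq_on_support L_supp) auto
  \<comment> \<open>The spline sum will equal
    \<open>exp (- \<beta> * v) * (p * J + q * (I * v + C))\<close>. Comparing slopes with
    \<open>c + d * v\<close> gives \<open>q\<close>, then comparing constants gives
    \<open>p\<close>.\<close>
  define q where "q = d / I"
  define p where "p = (c - q * C) / J"
  show ?thesis
  proof (rule that)
    fix v assume v: "v \<in> {3..real N + 1}"
    have exp_shift: "exp (- \<beta> * real j) * exp (- \<beta> * (v - real j)) = exp (- \<beta> * v)" for j
      by (simp add: algebra_simps flip: exp_add)
    have "exp (- \<beta> * real j) * (p + q * real j) * hb_unit_spline \<beta> (v - real j)
        = exp (- \<beta> * v) * (p * G (v - real j) + q * (real j * G (v - real j)))" for j
      unfolding exp_shift[of j, symmetric] hb_unit_spline_eq_moving_integral G_def L_def k_def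
      by (simp add: algebra_simps)
    then have "(\<Sum>j=0..N. exp (- \<beta> * real j) * (p + q * real j) * hb_unit_spline \<beta> (v - real j))
        = exp (- \<beta> * v) * (p * (\<Sum>j=0..N. G (v - real j))
            + q * (\<Sum>j=0..N. real j * G (v - real j)))"
      by (simp only: sum_distrib_left[symmetric] sum.distrib)
    also have "\<dots> = exp (- \<beta> * v) * (p * J + q * (I * v + C))"
      using C[OF v] sumG[OF v] by simp
    also have "p * J + q * (I * v + C) = c + d * v"
      using \<open>0 < I\<close> \<open>0 < J\<close> by (simp add: p_def q_def field_simps)
    finally show "(\<Sum>j=0..N. exp (- \<beta> * real j) * (p + q * real j) * hb_unit_spline \<beta> (v - real j))
        = exp (- \<beta> * v) * (c + d * v)" .
  qed
qed

section \<open>Vanishing penalty and interpolation by minimizers\<close>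

text \<open>With \<open>w = exp (- \<alpha> * h)\<close> and \<open>E\<close> the backward shift,
  the operator is \<open>(1 - w E)^2\<close>. Its double root makes it annihilate \<open>w^j\<close>
  times any linear polynomial in \<open>j\<close>.\<close>

lemma hp_diff_exp_linear:
  assumes "2 \<le> j"
  shows "hp_diff h \<alpha> (\<lambda>j. exp (- (\<alpha> * h) * real j) * (p + q * real j)) j = 0"
proof -
  \<comment> \<open>Factoring out \<open>e\<close> and \<open>exp (- 2 * \<alpha> * h)\<close>
    leaves the ordinary second difference of \<open>p + q * j\<close>.\<close>
  define e where "e = exp (- (\<alpha> * h) * (real j - 2))"
  have "exp (- (\<alpha> * h) * real j) = exp (- 2 * \<alpha> * h) * e"
    and "exp (- (\<alpha> * h) * real (j - 1)) = exp (- \<alpha> * h) * e"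
    and "exp (- 2 * \<alpha> * h) = exp (- \<alpha> * h) * exp (- \<alpha> * h)"
    and "exp (- (\<alpha> * h) * real (j - 2)) = e"
    using assms by (auto simp: e_def algebra_simps of_nat_diff simp flip: exp_add)
  then show ?thesis
    using assms by (simp add: hp_diff_def of_nat_diff algebra_simps)
qed

text \<open>The competitor \<open>c\<close> has objective value 0, while both summands of the
  objective are nonnegative, so the residual of any minimizer must vanish.\<close>

lemma hp_spline_interpolates:
  assumes "\<mu> \<ge> 0" "is_hp_spline \<alpha> h \<mu> n m B x y s"
    and fit: "\<And>i. i \<in> {1..m} \<Longrightarrow> (\<Sum>j=0..n+1. c j * B j (x i)) = y i"
    and pen: "\<And>j. j \<in> {2..n+1} \<Longrightarrow> hp_diff h \<alpha> c j = 0"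
    and i: "i \<in> {1..m}"
  shows "s (x i) = y i"
proof -
  obtain a where a: "is_arg_min (hp_objective \<alpha> h \<mu> n m B x y) (\<lambda>_. True) a"
    and s: "s = (\<lambda>t. \<Sum>j=0..n+1. a j * B j t)"
    using assms(2) unfolding is_hp_spline_def by blast
  let ?R = "\<Sum>i=1..m. (y i - s (x i))\<^sup>2"
  have "hp_objective \<alpha> h \<mu> n m B x y c = 0"
    unfolding hp_objective_def using fit pen by simp
  moreover have "hp_objective \<alpha> h \<mu> n m B x y a \<le> hp_objective \<alpha> h \<mu> n m B x y c"
    using a by (auto simp: is_arg_min_def not_less)
  ultimately have "?R + \<mu> * (\<Sum>j=2..n+1. (hp_diff h \<alpha> a j)\<^sup>2) \<le> 0"
    by (simp add: hp_objective_def s)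
  moreover have "0 \<le> \<mu> * (\<Sum>j=2..n+1. (hp_diff h \<alpha> a j)\<^sup>2)" "0 \<le> ?R"
    by (intro mult_nonneg_nonneg \<open>\<mu> \<ge> 0\<close> sum_nonneg zero_le_power2)+
  ultimately have "?R = 0"
    by linarith
  then have "(y i - s (x i))\<^sup>2 = 0"
    using i by (subst (asm) sum_nonneg_eq_0_iff) auto
  then show ?thesis by simp
qed

theorem proposition3p1:
  fixes \<alpha> \<mu> a b h :: real
    and n m :: nat
    and x y :: "nat \<Rightarrow> real"
    and \<xi> :: "int \<Rightarrow> real"
    and B :: "nat \<Rightarrow> real \<Rightarrow> real"
    and s f :: "real \<Rightarrow> real"
  assumes "\<mu> \<ge> 0"
    and "n \<ge> 2" and "m > n"
    and "strict_mono_on {1..m} x"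
    and "a = x 1" and "b = x m" and "h = (b - a) / (real n - 1)"
    and "\<And>l. l \<in> {-2..int n + 3} \<Longrightarrow> \<xi> l = a + (real_of_int l - 1) * h"
    and "B 0 = (\<lambda>t. hb_spline h (\<alpha> * h) (t - \<xi> (-2)))"
    and "\<And>j. j \<in> {1..n+1} \<Longrightarrow> B j = (\<lambda>t. B 0 (t - real j * h))"
    and "is_hp_spline \<alpha> h \<mu> n m B x y s"
    and "f \<in> exp_poly_space (- \<alpha>)"
    and "\<And>i. i \<in> {1..m} \<Longrightarrow> y i = f (x i)"
  shows "\<forall>i\<in>{1..m}. s (x i) = y i"
proof
  fix i assume i: "i \<in> {1..m}"
  have x_less: "x k < x l" if "k < l" "k \<in> {1..m}" "l \<in> {1..m}" for k l
    using assms(4) that by (auto simp: strict_mono_on_def)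
  have x_bounds: "a \<le> x k \<and> x k \<le> b" if "k \<in> {1..m}" for k
    using x_less[of 1 k] x_less[of k m] that assms(5,6)
    by (cases "k = 1"; cases "k = m") auto
  have "a < b"
    using x_less[of 1 m] assms(2,3,5,6) by simp
  then have "0 < h"
    using assms(2,7) by simp
  have b: "b = a + (real n - 1) * h"
    using assms(2,7) by simp
  have \<xi>: "\<xi> (-2) = a - 3 * h"
    using assms(8)[of "-2"] by simp
  \<comment> \<open>In the variable \<open>v = (t - a) / h + 3\<close>, the basis consists of
    integer shifts of one unit spline.\<close>
  have B: "B j t = hb_unit_spline (\<alpha> * h) ((t - a) / h + 3 - real j)" if "j \<in> {0..n+1}" for j t
  proof -
    have "B j t = B 0 (t - real j * h)"
      using that assms(10)[of j] by (cases "j = 0") auto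
    also have "\<dots> = hb_unit_spline (\<alpha> * h) ((t - real j * h - (a - 3 * h)) / h)"
      by (simp add: assms(9) hb_spline_def \<xi>)
    also have "(t - real j * h - (a - 3 * h)) / h = (t - a) / h + 3 - real j"
      using \<open>0 < h\<close> by (simp add: field_simps)
    finally show ?thesis .
  qed
  obtain c d where f: "f = (\<lambda>t. c * exp (- \<alpha> * t) + d * (t * exp (- \<alpha> * t)))"
    using assms(12) unfolding exp_poly_space_def by blast
  \<comment> \<open>Substituting \<open>t = a - 3 * h + h * v\<close> into \<open>f\<close> splits
    off \<open>K\<close>, the exponential at \<open>v = 0\<close>, and leaves a linear polynomial in
    \<open>v\<close> times \<open>exp (- (\<alpha> * h) * v)\<close>.\<close>
  define K where "K = exp (- \<alpha> * (a - 3 * h))"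
  obtain p q where pq: "\<And>v. v \<in> {3..real (n + 1) + 1} \<Longrightarrow>
    (\<Sum>j=0..n+1. exp (- (\<alpha> * h) * real j) * (p + q * real j) * hb_unit_spline (\<alpha> * h) (v - real j))
      = exp (- (\<alpha> * h) * v) * (K * (c + d * (a - 3 * h)) + K * d * h * v)"
    using hb_unit_spline_reproduction[of "n + 1" "\<alpha> * h"] by blast
  show "s (x i) = y i"
  proof (rule hp_spline_interpolates[OF assms(1,11) _ _ i])
    show "hp_diff h \<alpha> (\<lambda>j. exp (- (\<alpha> * h) * real j) * (p + q * real j)) j = 0"
      if "j \<in> {2..n+1}" for j
      using that by (intro hp_diff_exp_linear) simp
  next
    fix k assume k: "k \<in> {1..m}"
    define v where "v = (x k - a) / h + 3"
    have xk: "x k = a - 3 * h + h * v"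
      using \<open>0 < h\<close> by (simp add: v_def field_simps)
    \<comment> \<open>The data interval from \<open>a\<close> to \<open>b\<close> corresponds
      exactly to the reproduction range for \<open>N = n + 1\<close>, since
      \<open>(b - a) / h = n - 1\<close>.\<close>
    have "v \<in> {3..real (n + 1) + 1}"
      using x_bounds[OF k] \<open>0 < h\<close> b by (simp add: v_def field_simps)
    have "(\<Sum>j=0..n+1. exp (- (\<alpha> * h) * real j) * (p + q * real j) * B j (x k))
        = (\<Sum>j=0..n+1. exp (- (\<alpha> * h) * real j) * (p + q * real j)
            * hb_unit_spline (\<alpha> * h) (v - real j))"
      by (intro sum.cong refl) (simp only: B v_def)
    also have "\<dots> = exp (- (\<alpha> * h) * v) * (K * (c + d * (a - 3 * h)) + K * d * h * v)"
      by (rule pq) fact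
    also have "\<dots> = (K * exp (- (\<alpha> * h) * v)) * (c + d * x k)"
      by (simp add: xk algebra_simps)
    also have "K * exp (- (\<alpha> * h) * v) = exp (- \<alpha> * x k)"
      by (simp add: K_def xk algebra_simps flip: exp_add)
    also have "\<dots> * (c + d * x k) = y k"
      using assms(13)[OF k] by (simp add: f algebra_simps)
    finally show "(\<Sum>j=0..n+1. exp (- (\<alpha> * h) * real j) * (p + q * real j) * B j (x k)) = y k" .
  qed
qed

end
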